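(* Let $\{\bot\to\top\}$ be the free category on a morphism, endowed with the trivial model structure (weak equivalences are the isomorphisms, all morphisms are cofibrations and fibrations). Let $P\colon\mathrm{DblCat}\to\{\bot\to\top\}$ be the functor sending the empty double category $\emptyset$ to $\bot$ and every other double category to $\top$; it is left adjoint to the functor $\{\bot\to\top\}\to\mathrm{DblCat}$ that picks out the unique double functor $\emptyset\to\mathbf 1$. Then this adjunction is a Quillen equivalence between $\mathrm{DblCat}_{\emptyset/\mathrm{ctr}}$ and $\{\bot\to\top\}$.
   Context: **Double categories.** All double categories are small and strict (internal categories in $\mathrm{Cat}$): they have objects, horizontal morphisms, vertical morphisms, and squares, each square having a top and a bottom horizontal morphism and a left and a right vertical morphism. $\mathrm{DblCat}$ is the category of double categories and double functors; $\mathbf 1$ is the terminal double category. $\alpha\vert\beta$ is the horizontal composite ($\alpha$ to the left of $\beta$), $\frac{\alpha}{\beta}$ the vertical composite ($\alpha$ above $\beta$); $e_f$ is the vertical identity square at a horizontal morphism $f$, $\mathrm{id}_u$ the horizontal identity square at a vertical morphism $u$. A double functor is a *canonical trivial fibration* if it is surjective on objects, full on horizontal and on vertical morphisms, and fully faithful on squares (bijective on squares with any given boundary in the source). **Gregarious equivalences.** $\mathbf H\mathbb A$ is the underlying horizontal 2-category of $\mathbb A$ (objects, horizontal morphisms, and as 2-morphisms the squares whose left and right sides are identities), $\mathbf V\mathbb A$ the underlying vertical 2-category (directions exchanged). A *companion pair* $(f,u,\varphi,\psi)$ consists of a horizontal morphism $f\colon A\to B$, a vertical morphism $u$ from $A$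 to $B$, a square $\varphi$ with top $f$, left $u$, bottom and right identities at $B$, and a square $\psi$ with top and left identities at $A$, bottom $f$, right $u$, such that $\psi\vert\varphi=e_f$ and $\frac{\psi}{\varphi}=\mathrm{id}_u$. $\mathbf R\mathbb A$ is the 2-category with the objects of $\mathbb A$, companion pairs as morphisms, and as 2-morphisms $(f,u,\varphi,\psi)\Rightarrow(f',u',\varphi',\psi')$ the squares with top $f$, bottom $f'$ and identity left and right sides. A *gregarious equivalence* is a companion pair that is an equivalence in $\mathbf R\mathbb A$. A double functor $F\colon\mathbb A\to\mathbb B$ is a *gregarious double equivalence* if every object $B\in\mathbb B$ admits a gregarious equivalence $FA\to B$ for some $A\in\mathbb A$, the 2-functors $\mathbf HF$ and $\mathbf VF$ are essentially full on morphisms, and $F$ is fully faithful on squares. **Model structure.** $\mathrm{DblCat}_{\emptyset/\mathrm{ctr}}$ is the (existing, unique, cofibrantly generated) model structure on $\mathrm{DblCat}$ whose trivial fibrations are the canonical ones and whose fibrant objects are the double categories $\mathbb A$ such that $\mathbb A=\emptyset$ or $\mathbb A\to\mathbf 1$ is a gregarious double equivalence. Its weak equivalences between fibrant objects are the gregarious double equivalences. *)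

theory Defs
  imports
    "HOL-Library.FuncSet"
    "HOL-Library.Equipollence"
    "HOL-Library.Infinite_Typeclass"
begin

section \<open>Categories, functors, adjunctions\<close>

text \<open>Composition is written in diagrammatic order throughout: \<open>Comp C f g\<close> is
  ``first \<open>f\<close>, then \<open>g\<close>''.\<close>

record ('o, 'm) cat =
  Obj :: "'o set"
  Arr :: "'m set"
  Dom :: "'m \<Rightarrow> 'o"
  Cod :: "'m \<Rightarrow> 'o"
  Id :: "'o \<Rightarrow> 'm"
  Comp :: "'m \<Rightarrow> 'm \<Rightarrow> 'm"

definition hom_set :: "('o, 'm) cat \<Rightarrow> 'o \<Rightarrow> 'o \<Rightarrow> 'm set" where
  "hom_set C a b = {f \<in> Arr C. Dom C f = a \<and> Cod C f = b}"

definition category :: "('o, 'm) cat \<Rightarrow> bool" where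
  "category C \<longleftrightarrow>
    (\<forall>f\<in>Arr C. Dom C f \<in> Obj C \<and> Cod C f \<in> Obj C) \<and>
    (\<forall>a\<in>Obj C. Id C a \<in> hom_set C a a) \<and>
    (\<forall>f\<in>Arr C. \<forall>g\<in>Arr C. Cod C f = Dom C g \<longrightarrow> Comp C f g \<in> hom_set C (Dom C f) (Cod C g)) \<and>
    (\<forall>f\<in>Arr C. Comp C (Id C (Dom C f)) f = f \<and> Comp C f (Id C (Cod C f)) = f) \<and>
    (\<forall>f\<in>Arr C. \<forall>g\<in>Arr C. \<forall>h\<in>Arr C. Cod C f = Dom C g \<longrightarrow> Cod C g = Dom C h \<longrightarrow>
       Comp C (Comp C f g) h = Comp C f (Comp C g h))"

text \<open>The structure maps take the value \<open>undefined\<close> outside their domain of definition, so that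
  equality of records is equality of the underlying mathematical structures.\<close>

definition normalized :: "('o, 'm) cat \<Rightarrow> bool" where
  "normalized C \<longleftrightarrow>
    Dom C \<in> extensional (Arr C) \<and> Cod C \<in> extensional (Arr C) \<and> Id C \<in> extensional (Obj C) \<and>
    (\<forall>f g. \<not> (f \<in> Arr C \<and> g \<in> Arr C \<and> Cod C f = Dom C g) \<longrightarrow> Comp C f g = undefined)"

definition is_functor ::
    "('o, 'm) cat \<Rightarrow> ('p, 'n) cat \<Rightarrow> ('o \<Rightarrow> 'p) \<Rightarrow> ('m \<Rightarrow> 'n) \<Rightarrow> bool" where
  "is_functor C D fo fa \<longleftrightarrow>
    (\<forall>a\<in>Obj C. fo a \<in> Obj D) \<and>
    (\<forall>f\<in>Arr C. fa f \<in> hom_set D (fo (Dom C f)) (fo (Cod C f))) \<and>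
    (\<forall>a\<in>Obj C. fa (Id C a) = Id D (fo a)) \<and>
    (\<forall>f\<in>Arr C. \<forall>g\<in>Arr C. Cod C f = Dom C g \<longrightarrow> fa (Comp C f g) = Comp D (fa f) (fa g))"

definition is_iso :: "('o, 'm) cat \<Rightarrow> 'm \<Rightarrow> bool" where
  "is_iso C f \<longleftrightarrow> f \<in> Arr C \<and>
    (\<exists>g\<in>hom_set C (Cod C f) (Dom C f).
       Comp C f g = Id C (Dom C f) \<and> Comp C g f = Id C (Cod C f))"

definition isomorphic_in :: "('o, 'm) cat \<Rightarrow> 'o \<Rightarrow> 'o \<Rightarrow> bool" where
  "isomorphic_in C a b \<longleftrightarrow> (\<exists>f\<in>hom_set C a b. is_iso C f)"

definition terminal_obj :: "('o, 'm) cat \<Rightarrow> 'o \<Rightarrow> bool" where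
  "terminal_obj C t \<longleftrightarrow> t \<in> Obj C \<and> (\<forall>a\<in>Obj C. \<exists>!f. f \<in> hom_set C a t)"

definition initial_obj :: "('o, 'm) cat \<Rightarrow> 'o \<Rightarrow> bool" where
  "initial_obj C i \<longleftrightarrow> i \<in> Obj C \<and> (\<forall>a\<in>Obj C. \<exists>!f. f \<in> hom_set C i a)"

text \<open>\<open>(lo, la)\<close> is left adjoint to \<open>(ro, ra)\<close>, with \<open>\<tau> c d\<close> the bijection
  \<open>D(L c, d) \<cong> C(c, R d)\<close>, natural in \<open>c\<close> and \<open>d\<close>.\<close>

definition adjunction ::
    "('o, 'm) cat \<Rightarrow> ('p, 'n) cat \<Rightarrow> ('o \<Rightarrow> 'p) \<Rightarrow> ('m \<Rightarrow> 'n) \<Rightarrow> ('p \<Rightarrow> 'o) \<Rightarrow> ('n \<Rightarrow> 'm) \<Rightarrow>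
     ('o \<Rightarrow> 'p \<Rightarrow> 'n \<Rightarrow> 'm) \<Rightarrow> bool" where
  "adjunction C D lo la ro ra \<tau> \<longleftrightarrow>
    category C \<and> category D \<and> is_functor C D lo la \<and> is_functor D C ro ra \<and>
    (\<forall>c\<in>Obj C. \<forall>d\<in>Obj D. bij_betw (\<tau> c d) (hom_set D (lo c) d) (hom_set C c (ro d))) \<and>
    (\<forall>f\<in>Arr C. \<forall>g\<in>Arr D. \<forall>h\<in>hom_set D (lo (Cod C f)) (Dom D g).
       \<tau> (Dom C f) (Cod D g) (Comp D (la f) (Comp D h g)) =
       Comp C f (Comp C (\<tau> (Cod C f) (Dom D g) h) (ra g)))"


section \<open>Model structures and Quillen equivalences\<close>

record 'm model =
  Weq :: "'m set"
  Cof :: "'m set"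
  Fib :: "'m set"

definition two_out_of_three :: "('o, 'm) cat \<Rightarrow> 'm set \<Rightarrow> bool" where
  "two_out_of_three C W \<longleftrightarrow>
    (\<forall>f\<in>Arr C. \<forall>g\<in>Arr C. Cod C f = Dom C g \<longrightarrow>
       (f \<in> W \<and> g \<in> W \<longrightarrow> Comp C f g \<in> W) \<and>
       (f \<in> W \<and> Comp C f g \<in> W \<longrightarrow> g \<in> W) \<and>
       (g \<in> W \<and> Comp C f g \<in> W \<longrightarrow> f \<in> W))"

definition retract_of :: "('o, 'm) cat \<Rightarrow> 'm \<Rightarrow> 'm \<Rightarrow> bool" where
  "retract_of C f g \<longleftrightarrow> f \<in> Arr C \<and> g \<in> Arr C \<and>
    (\<exists>i\<in>hom_set C (Dom C f) (Dom C g). \<exists>r\<in>hom_set C (Dom C g) (Dom C f).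
     \<exists>j\<in>hom_set C (Cod C f) (Cod C g). \<exists>s\<in>hom_set C (Cod C g) (Cod C f).
       Comp C i r = Id C (Dom C f) \<and> Comp C j s = Id C (Cod C f) \<and>
       Comp C i g = Comp C f j \<and> Comp C r f = Comp C g s)"

definition retract_closed :: "('o, 'm) cat \<Rightarrow> 'm set \<Rightarrow> bool" where
  "retract_closed C S \<longleftrightarrow> (\<forall>f g. g \<in> S \<longrightarrow> retract_of C f g \<longrightarrow> f \<in> S)"

definition has_lifting :: "('o, 'm) cat \<Rightarrow> 'm \<Rightarrow> 'm \<Rightarrow> bool" where
  "has_lifting C i p \<longleftrightarrow>
    (\<forall>s\<in>hom_set C (Dom C i) (Dom C p). \<forall>t\<in>hom_set C (Cod C i) (Cod C p).
       Comp C s p = Comp C i t \<longrightarrow>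
       (\<exists>l\<in>hom_set C (Cod C i) (Dom C p). Comp C i l = s \<and> Comp C l p = t))"

definition model_structure :: "('o, 'm) cat \<Rightarrow> 'm model \<Rightarrow> bool" where
  "model_structure C M \<longleftrightarrow>
    category C \<and>
    Weq M \<subseteq> Arr C \<and> Cof M \<subseteq> Arr C \<and> Fib M \<subseteq> Arr C \<and>
    two_out_of_three C (Weq M) \<and>
    retract_closed C (Weq M) \<and> retract_closed C (Cof M) \<and> retract_closed C (Fib M) \<and>
    (\<forall>i\<in>Cof M. \<forall>p\<in>Fib M. i \<in> Weq M \<or> p \<in> Weq M \<longrightarrow> has_lifting C i p) \<and>
    (\<forall>f\<in>Arr C. \<exists>i\<in>Cof M. \<exists>p\<in>Fib M \<inter> Weq M.
       Dom C i = Dom C f \<and> Cod C i = Dom C p \<and> Cod C p = Cod C f \<and> f = Comp C i p) \<and>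
    (\<forall>f\<in>Arr C. \<exists>i\<in>Cof M \<inter> Weq M. \<exists>p\<in>Fib M.
       Dom C i = Dom C f \<and> Cod C i = Dom C p \<and> Cod C p = Cod C f \<and> f = Comp C i p)"

definition fibrant :: "('o, 'm) cat \<Rightarrow> 'm model \<Rightarrow> 'o \<Rightarrow> bool" where
  "fibrant C M a \<longleftrightarrow> a \<in> Obj C \<and> (\<exists>t. terminal_obj C t \<and> (\<exists>f\<in>hom_set C a t. f \<in> Fib M))"

definition cofibrant :: "('o, 'm) cat \<Rightarrow> 'm model \<Rightarrow> 'o \<Rightarrow> bool" where
  "cofibrant C M a \<longleftrightarrow> a \<in> Obj C \<and> (\<exists>i. initial_obj C i \<and> (\<exists>f\<in>hom_set C i a. f \<in> Cof M))"

definition trivial_model :: "('o, 'm) cat \<Rightarrow> 'm model" where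
  "trivial_model C = \<lparr>Weq = {f. is_iso C f}, Cof = Arr C, Fib = Arr C\<rparr>"

definition quillen_adjunction ::
    "('o, 'm) cat \<Rightarrow> 'm model \<Rightarrow> ('p, 'n) cat \<Rightarrow> 'n model \<Rightarrow>
     ('o \<Rightarrow> 'p) \<Rightarrow> ('m \<Rightarrow> 'n) \<Rightarrow> ('p \<Rightarrow> 'o) \<Rightarrow> ('n \<Rightarrow> 'm) \<Rightarrow> ('o \<Rightarrow> 'p \<Rightarrow> 'n \<Rightarrow> 'm) \<Rightarrow> bool" where
  "quillen_adjunction C M D N lo la ro ra \<tau> \<longleftrightarrow>
    model_structure C M \<and> model_structure D N \<and> adjunction C D lo la ro ra \<tau> \<and>
    (\<forall>f\<in>Cof M. la f \<in> Cof N) \<and>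
    (\<forall>f\<in>Cof M \<inter> Weq M. la f \<in> Cof N \<inter> Weq N)"

definition quillen_equivalence ::
    "('o, 'm) cat \<Rightarrow> 'm model \<Rightarrow> ('p, 'n) cat \<Rightarrow> 'n model \<Rightarrow>
     ('o \<Rightarrow> 'p) \<Rightarrow> ('m \<Rightarrow> 'n) \<Rightarrow> ('p \<Rightarrow> 'o) \<Rightarrow> ('n \<Rightarrow> 'm) \<Rightarrow> ('o \<Rightarrow> 'p \<Rightarrow> 'n \<Rightarrow> 'm) \<Rightarrow> bool" where
  "quillen_equivalence C M D N lo la ro ra \<tau> \<longleftrightarrow>
    quillen_adjunction C M D N lo la ro ra \<tau> \<and>
    (\<forall>c d. cofibrant C M c \<longrightarrow> fibrant D N d \<longrightarrow>
       (\<forall>h\<in>hom_set D (lo c) d. h \<in> Weq N \<longleftrightarrow> \<tau> c d h \<in> Weq M))"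


section \<open>Double categories\<close>

text \<open>\<open>hcomp A f g\<close> and \<open>vcomp A u v\<close> compose horizontal, respectively vertical, morphisms.
  For squares, \<open>sqh A \<alpha> \<beta>\<close> is the horizontal composite (\<open>\<alpha>\<close> to the left of \<open>\<beta>\<close>),
  \<open>sqv A \<alpha> \<beta>\<close> the vertical composite (\<open>\<alpha>\<close> above \<open>\<beta>\<close>), \<open>sq_e A f\<close> the vertical identity square
  at a horizontal morphism and \<open>sq_id A u\<close> the horizontal identity square at a vertical morphism.\<close>

record 'u dblcat =
  Ob :: "'u set"
  Hor :: "'u set"
  Ver :: "'u set"
  Sq :: "'u set"
  hdom :: "'u \<Rightarrow> 'u"
  hcod :: "'u \<Rightarrow> 'u"
  hid :: "'u \<Rightarrow> 'u"
  hcomp :: "'u \<Rightarrow> 'u \<Rightarrow> 'u"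
  vdom :: "'u \<Rightarrow> 'u"
  vcod :: "'u \<Rightarrow> 'u"
  vid :: "'u \<Rightarrow> 'u"
  vcomp :: "'u \<Rightarrow> 'u \<Rightarrow> 'u"
  top_side :: "'u \<Rightarrow> 'u"
  bot_side :: "'u \<Rightarrow> 'u"
  left_side :: "'u \<Rightarrow> 'u"
  right_side :: "'u \<Rightarrow> 'u"
  sq_e :: "'u \<Rightarrow> 'u"
  sqv :: "'u \<Rightarrow> 'u \<Rightarrow> 'u"
  sq_id :: "'u \<Rightarrow> 'u"
  sqh :: "'u \<Rightarrow> 'u \<Rightarrow> 'u"

definition HorCat :: "'u dblcat \<Rightarrow> ('u, 'u) cat" where
  "HorCat A = \<lparr>Obj = Ob A, Arr = Hor A, Dom = hdom A, Cod = hcod A, Id = hid A, Comp = hcomp A\<rparr>"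

definition VerCat :: "'u dblcat \<Rightarrow> ('u, 'u) cat" where
  "VerCat A = \<lparr>Obj = Ob A, Arr = Ver A, Dom = vdom A, Cod = vcod A, Id = vid A, Comp = vcomp A\<rparr>"

text \<open>Squares under vertical composition (as morphisms between horizontal morphisms) and under
  horizontal composition (as morphisms between vertical morphisms).\<close>

definition SqVCat :: "'u dblcat \<Rightarrow> ('u, 'u) cat" where
  "SqVCat A = \<lparr>Obj = Hor A, Arr = Sq A, Dom = top_side A, Cod = bot_side A,
     Id = sq_e A, Comp = sqv A\<rparr>"

definition SqHCat :: "'u dblcat \<Rightarrow> ('u, 'u) cat" where
  "SqHCat A = \<lparr>Obj = Ver A, Arr = Sq A, Dom = left_side A, Cod = right_side A,
     Id = sq_id A, Comp = sqh A\<rparr>"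

text \<open>Internal categories in \<open>Cat\<close>: the category of objects is \<open>VerCat A\<close>, the category of
  morphisms is \<open>SqVCat A\<close>; source, target, identity are the three displayed functors, and the last
  conjunct says that horizontal composition is a functor (on the pullback of target and source).
  The unit and associativity laws are contained in \<open>category (HorCat A)\<close> and
  \<open>category (SqHCat A)\<close>.\<close>

definition double_category :: "'u dblcat \<Rightarrow> bool" where
  "double_category A \<longleftrightarrow>
    category (HorCat A) \<and> category (VerCat A) \<and> category (SqVCat A) \<and> category (SqHCat A) \<and>
    normalized (HorCat A) \<and> normalized (VerCat A) \<and>
    normalized (SqVCat A) \<and> normalized (SqHCat A) \<and>
    is_functor (SqVCat A) (VerCat A) (hdom A) (left_side A) \<and>
    is_functor (SqVCat A) (VerCat A) (hcod A) (right_side A) \<and>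
    is_functor (VerCat A) (SqVCat A) (hid A) (sq_id A) \<and>
    (\<forall>\<alpha>\<in>Sq A. \<forall>\<beta>\<in>Sq A. right_side A \<alpha> = left_side A \<beta> \<longrightarrow>
       top_side A (sqh A \<alpha> \<beta>) = hcomp A (top_side A \<alpha>) (top_side A \<beta>) \<and>
       bot_side A (sqh A \<alpha> \<beta>) = hcomp A (bot_side A \<alpha>) (bot_side A \<beta>)) \<and>
    (\<forall>f\<in>Hor A. \<forall>g\<in>Hor A. hcod A f = hdom A g \<longrightarrow>
       sq_e A (hcomp A f g) = sqh A (sq_e A f) (sq_e A g)) \<and>
    (\<forall>\<alpha>\<in>Sq A. \<forall>\<beta>\<in>Sq A. \<forall>\<gamma>\<in>Sq A. \<forall>\<delta>\<in>Sq A.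
       right_side A \<alpha> = left_side A \<beta> \<longrightarrow> right_side A \<gamma> = left_side A \<delta> \<longrightarrow>
       bot_side A \<alpha> = top_side A \<gamma> \<longrightarrow> bot_side A \<beta> = top_side A \<delta> \<longrightarrow>
       sqv A (sqh A \<alpha> \<beta>) (sqh A \<gamma> \<delta>) = sqh A (sqv A \<alpha> \<gamma>) (sqv A \<beta> \<delta>))"

record 'u dblfun =
  src :: "'u dblcat"
  tgt :: "'u dblcat"
  fob :: "'u \<Rightarrow> 'u"
  fhor :: "'u \<Rightarrow> 'u"
  fver :: "'u \<Rightarrow> 'u"
  fsq :: "'u \<Rightarrow> 'u"

definition double_functor :: "'u dblfun \<Rightarrow> bool" where
  "double_functor F \<longleftrightarrow> (let A = src F; B = tgt F in
    is_functor (HorCat A) (HorCat B) (fob F) (fhor F) \<and>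
    is_functor (VerCat A) (VerCat B) (fob F) (fver F) \<and>
    is_functor (SqVCat A) (SqVCat B) (fhor F) (fsq F) \<and>
    is_functor (SqHCat A) (SqHCat B) (fver F) (fsq F) \<and>
    fob F \<in> extensional (Ob A) \<and> fhor F \<in> extensional (Hor A) \<and>
    fver F \<in> extensional (Ver A) \<and> fsq F \<in> extensional (Sq A))"

text \<open>Smallness is relative to the type \<open>'u\<close>: a set is small if its cardinality is less than that
  of \<open>'u\<close>. If the cardinality of \<open>'u\<close> is inaccessible, these are (up to bijection) the sets of a
  Grothendieck universe; the definitions make sense for any infinite \<open>'u\<close>.\<close>

definition small :: "'u dblcat \<Rightarrow> bool" where
  "small A \<longleftrightarrow> Ob A \<prec> (UNIV :: 'u set) \<and> Hor A \<prec> (UNIV :: 'u set) \<and>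
     Ver A \<prec> (UNIV :: 'u set) \<and> Sq A \<prec> (UNIV :: 'u set)"

definition dbl_id :: "'u dblcat \<Rightarrow> 'u dblfun" where
  "dbl_id A = \<lparr>src = A, tgt = A, fob = restrict id (Ob A), fhor = restrict id (Hor A),
     fver = restrict id (Ver A), fsq = restrict id (Sq A)\<rparr>"

definition dbl_comp :: "'u dblfun \<Rightarrow> 'u dblfun \<Rightarrow> 'u dblfun" where
  "dbl_comp F G = \<lparr>src = src F, tgt = tgt G,
     fob = compose (Ob (src F)) (fob G) (fob F),
     fhor = compose (Hor (src F)) (fhor G) (fhor F),
     fver = compose (Ver (src F)) (fver G) (fver F),
     fsq = compose (Sq (src F)) (fsq G) (fsq F)\<rparr>"

definition DblCat :: "('u::infinite dblcat, 'u dblfun) cat" where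
  "DblCat = \<lparr>
     Obj = {A. double_category A \<and> small A},
     Arr = {F. double_category (src F) \<and> small (src F) \<and>
               double_category (tgt F) \<and> small (tgt F) \<and> double_functor F},
     Dom = src, Cod = tgt, Id = dbl_id, Comp = dbl_comp\<rparr>"

definition empty_dbl :: "'u dblcat" where
  "empty_dbl = (let k = (\<lambda>x. undefined); c = (\<lambda>x y. undefined) in
     \<lparr>Ob = {}, Hor = {}, Ver = {}, Sq = {},
      hdom = k, hcod = k, hid = k, hcomp = c,
      vdom = k, vcod = k, vid = k, vcomp = c,
      top_side = k, bot_side = k, left_side = k, right_side = k,
      sq_e = k, sqv = c, sq_id = k, sqh = c\<rparr>)"

text \<open>The terminal double category. Its unique cells are all chosen to be \<open>undefined\<close>, so that
  the constant functions below also satisfy the normalization convention.\<close>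

definition one_dbl :: "'u dblcat" where
  "one_dbl = (let k = (\<lambda>x. undefined); c = (\<lambda>x y. undefined) in
     \<lparr>Ob = {undefined}, Hor = {undefined}, Ver = {undefined}, Sq = {undefined},
      hdom = k, hcod = k, hid = k, hcomp = c,
      vdom = k, vcod = k, vid = k, vcomp = c,
      top_side = k, bot_side = k, left_side = k, right_side = k,
      sq_e = k, sqv = c, sq_id = k, sqh = c\<rparr>)"

text \<open>The double functor from \<open>A\<close> to \<open>B\<close> with constant value \<open>undefined\<close>. It is used when \<open>B\<close> is
  \<open>one_dbl\<close>, or when \<open>A\<close> and \<open>B\<close> are both \<open>empty_dbl\<close>, and is then the unique
  double functor from \<open>A\<close> to \<open>B\<close>.\<close>

definition const_dbl :: "'u dblcat \<Rightarrow> 'u dblcat \<Rightarrow> 'u dblfun" where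
  "const_dbl A B = \<lparr>src = A, tgt = B, fob = (\<lambda>x. undefined), fhor = (\<lambda>x. undefined),
     fver = (\<lambda>x. undefined), fsq = (\<lambda>x. undefined)\<rparr>"


section \<open>Canonical trivial fibrations\<close>

definition squares_with ::
    "'u dblcat \<Rightarrow> 'u \<Rightarrow> 'u \<Rightarrow> 'u \<Rightarrow> 'u \<Rightarrow> 'u set" where
  "squares_with A f f' u v = {\<alpha> \<in> Sq A. top_side A \<alpha> = f \<and> bot_side A \<alpha> = f' \<and>
     left_side A \<alpha> = u \<and> right_side A \<alpha> = v}"

definition fully_faithful_on_squares :: "'u dblfun \<Rightarrow> bool" where
  "fully_faithful_on_squares F \<longleftrightarrow> (let A = src F; B = tgt F in
    \<forall>f\<in>Hor A. \<forall>f'\<in>Hor A. \<forall>u\<in>Ver A. \<forall>v\<in>Ver A.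
      hdom A f = vdom A u \<longrightarrow> hcod A f = vdom A v \<longrightarrow>
      hdom A f' = vcod A u \<longrightarrow> hcod A f' = vcod A v \<longrightarrow>
      bij_betw (fsq F) (squares_with A f f' u v)
        (squares_with B (fhor F f) (fhor F f') (fver F u) (fver F v)))"

definition full_on :: "('o, 'm) cat \<Rightarrow> ('p, 'n) cat \<Rightarrow> ('o \<Rightarrow> 'p) \<Rightarrow> ('m \<Rightarrow> 'n) \<Rightarrow> bool" where
  "full_on C D fo fa \<longleftrightarrow>
    (\<forall>a\<in>Obj C. \<forall>b\<in>Obj C. \<forall>g\<in>hom_set D (fo a) (fo b). \<exists>f\<in>hom_set C a b. fa f = g)"

definition canonical_trivial_fibration :: "'u dblfun \<Rightarrow> bool" where
  "canonical_trivial_fibration F \<longleftrightarrow>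
    fob F ` Ob (src F) = Ob (tgt F) \<and>
    full_on (HorCat (src F)) (HorCat (tgt F)) (fob F) (fhor F) \<and>
    full_on (VerCat (src F)) (VerCat (tgt F)) (fob F) (fver F) \<and>
    fully_faithful_on_squares F"


section \<open>Underlying 2-categories and gregarious double equivalences\<close>

text \<open>\<open>Und\<close> is the category of objects and morphisms; \<open>Cells\<close> is the category whose objects are
  the morphisms and whose arrows are the 2-morphisms under vertical composition; \<open>HComp\<close> is
  horizontal composition of 2-morphisms.\<close>

record ('o, 'm, 'c) twocat =
  Und :: "('o, 'm) cat"
  Cells :: "('m, 'c) cat"
  HComp :: "'c \<Rightarrow> 'c \<Rightarrow> 'c"

definition equivalence_in :: "('o, 'm, 'c) twocat \<Rightarrow> 'm \<Rightarrow> bool" where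
  "equivalence_in K f \<longleftrightarrow> f \<in> Arr (Und K) \<and>
    (\<exists>g\<in>hom_set (Und K) (Cod (Und K) f) (Dom (Und K) f).
       isomorphic_in (Cells K) (Id (Und K) (Dom (Und K) f)) (Comp (Und K) f g) \<and>
       isomorphic_in (Cells K) (Comp (Und K) g f) (Id (Und K) (Cod (Und K) f)))"

text \<open>A 2-functor from \<open>K\<close> to \<open>L\<close>, here through its action \<open>fo\<close> on objects and \<open>fm\<close> on morphisms,
  is essentially full on morphisms if every morphism \<open>fo a \<rightarrow> fo b\<close> is isomorphic, by an invertible
  2-morphism, to the image of some morphism \<open>a \<rightarrow> b\<close>.\<close>

definition ess_full_on_morphisms ::
    "('o, 'm, 'c) twocat \<Rightarrow> ('p, 'n, 'd) twocat \<Rightarrow> ('o \<Rightarrow> 'p) \<Rightarrow> ('m \<Rightarrow> 'n) \<Rightarrow> bool" where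
  "ess_full_on_morphisms K L fo fm \<longleftrightarrow>
    (\<forall>a\<in>Obj (Und K). \<forall>b\<in>Obj (Und K). \<forall>g\<in>hom_set (Und L) (fo a) (fo b).
       \<exists>f\<in>hom_set (Und K) a b. isomorphic_in (Cells L) (fm f) g)"

definition horizontal_2cat :: "'u dblcat \<Rightarrow> ('u, 'u, 'u) twocat" where
  "horizontal_2cat A = \<lparr>
     Und = HorCat A,
     Cells = (SqVCat A)\<lparr>Arr := {\<alpha> \<in> Sq A.
        left_side A \<alpha> = vid A (hdom A (top_side A \<alpha>)) \<and>
        right_side A \<alpha> = vid A (hcod A (top_side A \<alpha>))}\<rparr>,
     HComp = sqh A\<rparr>"

definition vertical_2cat :: "'u dblcat \<Rightarrow> ('u, 'u, 'u) twocat" where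
  "vertical_2cat A = \<lparr>
     Und = VerCat A,
     Cells = (SqHCat A)\<lparr>Arr := {\<alpha> \<in> Sq A.
        top_side A \<alpha> = hid A (vdom A (left_side A \<alpha>)) \<and>
        bot_side A \<alpha> = hid A (vcod A (left_side A \<alpha>))}\<rparr>,
     HComp = sqv A\<rparr>"

record 'u companion =
  ch :: 'u
  cv :: 'u
  cphi :: 'u
  cpsi :: 'u

definition companion_pair :: "'u dblcat \<Rightarrow> 'u companion \<Rightarrow> bool" where
  "companion_pair A p \<longleftrightarrow> (let f = ch p; u = cv p; \<phi> = cphi p; \<psi> = cpsi p; a = hdom A f; b = hcod A f in
    f \<in> Hor A \<and> u \<in> Ver A \<and> vdom A u = a \<and> vcod A u = b \<and>
    \<phi> \<in> squares_with A f (hid A b) u (vid A b) \<and>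
    \<psi> \<in> squares_with A (hid A a) f (vid A a) u \<and>
    sqh A \<psi> \<phi> = sq_e A f \<and> sqv A \<psi> \<phi> = sq_id A u)"

definition companion_id :: "'u dblcat \<Rightarrow> 'u \<Rightarrow> 'u companion" where
  "companion_id A a = \<lparr>ch = hid A a, cv = vid A a,
     cphi = sq_e A (hid A a), cpsi = sq_e A (hid A a)\<rparr>"

text \<open>The two squares of a composite of companion pairs are the composites of the two-by-two grids
  with rows \<open>\<phi>, e\<^sub>g\<close> and \<open>id\<^sub>v, \<phi>'\<close>, respectively \<open>\<psi>, id\<^sub>u\<close> and \<open>e\<^sub>f, \<psi>'\<close>.\<close>

definition companion_comp :: "'u dblcat \<Rightarrow> 'u companion \<Rightarrow> 'u companion \<Rightarrow> 'u companion" where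
  "companion_comp A p q = \<lparr>ch = hcomp A (ch p) (ch q), cv = vcomp A (cv p) (cv q),
     cphi = sqv A (sqh A (cphi p) (sq_e A (ch q))) (sqh A (sq_id A (cv q)) (cphi q)),
     cpsi = sqv A (sqh A (cpsi p) (sq_id A (cv p))) (sqh A (sq_e A (ch p)) (cpsi q))\<rparr>"

text \<open>A 2-morphism is a triple \<open>(p, \<alpha>, q)\<close> of its source, its underlying square and its target,
  since the square alone does not determine the companion pairs.\<close>

definition companion_2cat ::
    "'u dblcat \<Rightarrow> ('u, 'u companion, 'u companion \<times> 'u \<times> 'u companion) twocat" where
  "companion_2cat A = \<lparr>
     Und = \<lparr>Obj = Ob A, Arr = {p. companion_pair A p},
            Dom = (\<lambda>p. hdom A (ch p)), Cod = (\<lambda>p. hcod A (ch p)),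
            Id = companion_id A, Comp = companion_comp A\<rparr>,
     Cells = \<lparr>Obj = {p. companion_pair A p},
              Arr = {(p, \<alpha>, q). companion_pair A p \<and> companion_pair A q \<and>
                 \<alpha> \<in> squares_with A (ch p) (ch q) (vid A (hdom A (ch p))) (vid A (hcod A (ch p)))},
              Dom = (\<lambda>(p, \<alpha>, q). p), Cod = (\<lambda>(p, \<alpha>, q). q),
              Id = (\<lambda>p. (p, sq_e A (ch p), p)),
              Comp = (\<lambda>(p, \<alpha>, q) (q', \<beta>, r). (p, sqv A \<alpha> \<beta>, r))\<rparr>,
     HComp = (\<lambda>(p, \<alpha>, q) (p', \<alpha>', q').
        (companion_comp A p p', sqh A \<alpha> \<alpha>', companion_comp A q q'))\<rparr>"

definition gregarious_equivalence :: "'u dblcat \<Rightarrow> 'u companion \<Rightarrow> bool" where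
  "gregarious_equivalence A p \<longleftrightarrow> equivalence_in (companion_2cat A) p"

definition gregarious_double_equivalence :: "'u dblfun \<Rightarrow> bool" where
  "gregarious_double_equivalence F \<longleftrightarrow>
    (\<forall>b\<in>Ob (tgt F). \<exists>a\<in>Ob (src F). \<exists>p. gregarious_equivalence (tgt F) p \<and>
       hdom (tgt F) (ch p) = fob F a \<and> hcod (tgt F) (ch p) = b) \<and>
    ess_full_on_morphisms (horizontal_2cat (src F)) (horizontal_2cat (tgt F)) (fob F) (fhor F) \<and>
    ess_full_on_morphisms (vertical_2cat (src F)) (vertical_2cat (tgt F)) (fob F) (fver F) \<and>
    fully_faithful_on_squares F"


section \<open>The model structure and the adjunction\<close>

text \<open>A model structure is determined by its trivial fibrations and its fibrant objects, so the
  following predicate characterizes \<open>M\<close>.\<close>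

definition is_DblCat_empty_ctr :: "('u::infinite) dblfun model \<Rightarrow> bool" where
  "is_DblCat_empty_ctr M \<longleftrightarrow>
    model_structure DblCat M \<and>
    (\<forall>F\<in>Arr DblCat. F \<in> Fib M \<inter> Weq M \<longleftrightarrow> canonical_trivial_fibration F) \<and>
    (\<forall>A\<in>Obj DblCat. fibrant DblCat M A \<longleftrightarrow>
       A = empty_dbl \<or> gregarious_double_equivalence (const_dbl A one_dbl))"

text \<open>The free category on a morphism: \<open>\<bottom>\<close> is \<open>False\<close>, \<open>\<top>\<close> is \<open>True\<close>, and the
  arrows are the pairs \<open>(a, b)\<close> with \<open>a \<le> b\<close>.\<close>

definition Arrow_Cat :: "(bool, bool \<times> bool) cat" where
  "Arrow_Cat = \<lparr>Obj = UNIV, Arr = {(a, b). a \<le> b}, Dom = fst, Cod = snd,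
     Id = (\<lambda>a. (a, a)), Comp = (\<lambda>f g. (fst f, snd g))\<rparr>"

definition P_ob :: "'u dblcat \<Rightarrow> bool" where
  "P_ob A \<longleftrightarrow> A \<noteq> empty_dbl"

definition P_arr :: "'u dblfun \<Rightarrow> bool \<times> bool" where
  "P_arr F = (P_ob (src F), P_ob (tgt F))"

definition R_ob :: "bool \<Rightarrow> 'u dblcat" where
  "R_ob b = (if b then one_dbl else empty_dbl)"

definition R_arr :: "bool \<times> bool \<Rightarrow> 'u dblfun" where
  "R_arr f = const_dbl (R_ob (fst f)) (R_ob (snd f))"

text \<open>The adjunction bijection sends \<open>P A \<rightarrow> X\<close> to the unique double functor \<open>A \<rightarrow> R X\<close>.\<close>

definition PR_transpose :: "'u dblcat \<Rightarrow> bool \<Rightarrow> bool \<times> bool \<Rightarrow> 'u dblfun" where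
  "PR_transpose A X h = const_dbl A (R_ob X)"

end

theory Submission
  imports Defs
begin

text \<open>A double functor out of a nonempty double category has nonempty target, and \<open>\<emptyset>\<close> is
  fibrant, so a trivial cofibration \<open>\<emptyset> \<rightarrow> B\<close> lifts against \<open>\<emptyset> \<rightarrow> \<one>\<close> and forces \<open>B = \<emptyset>\<close>.
  Hence \<open>P\<close> preserves trivial cofibrations, and \<open>\<emptyset> \<rightarrow> \<one>\<close> is not a weak equivalence: its factorization
  into a trivial cofibration and a fibration would make it a trivial fibration. Conversely, a
  gregarious double equivalence to \<open>\<one>\<close> is already a canonical trivial fibration, so replacing a
  nonempty \<open>A\<close> fibrantly shows that \<open>A \<rightarrow> \<one>\<close> is a weak equivalence.\<close>

lemma Comp_in_hom_set:
  assumes "category C" "f \<in> hom_set C a b" "g \<in> hom_set C b c"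
  shows "Comp C f g \<in> hom_set C a c"
proof -
  have "f \<in> Arr C" "g \<in> Arr C" "Cod C f = Dom C g" "Dom C f = a" "Cod C g = c"
    using assms by (auto simp: hom_set_def)
  then show ?thesis using assms(1) unfolding category_def by blast
qed

section \<open>The free arrow and its trivial model structure\<close>

lemma category_Arrow_Cat: "category Arrow_Cat"
  by (auto simp: category_def Arrow_Cat_def hom_set_def)

text \<open>\<open>Arrow_Cat\<close> is a poset, so an invertible arrow joins an object to
  itself.\<close>

lemma is_iso_Arrow_Cat: "is_iso Arrow_Cat f \<longleftrightarrow> fst f = snd f"
  by (cases f) (auto simp: is_iso_def Arrow_Cat_def hom_set_def)

lemma model_structure_trivial_Arrow_Cat: "model_structure Arrow_Cat (trivial_model Arrow_Cat)"
  unfolding model_structure_def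
proof (intro conjI)
  let ?N = "trivial_model Arrow_Cat"
  have arr: "f \<in> Arr Arrow_Cat \<longleftrightarrow> (fst f \<longrightarrow> snd f)" for f
    by (cases f) (auto simp: Arrow_Cat_def)
  have weq: "f \<in> Weq ?N \<longleftrightarrow> fst f = snd f" for f
    by (simp add: trivial_model_def is_iso_Arrow_Cat)
  have cof: "Cof ?N = Arr Arrow_Cat" and fib: "Fib ?N = Arr Arrow_Cat"
    by (simp_all add: trivial_model_def)
  have [simp]: "Dom Arrow_Cat = fst" "Cod Arrow_Cat = snd"
    "Comp Arrow_Cat f g = (fst f, snd g)" "Id Arrow_Cat a = (a, a)" for f g a
    by (simp_all add: Arrow_Cat_def)
  have hom: "f \<in> hom_set Arrow_Cat a b \<longleftrightarrow> f = (a, b) \<and> (a \<longrightarrow> b)" for f a b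
    by (cases f) (auto simp: hom_set_def arr)
  show "category Arrow_Cat" by (rule category_Arrow_Cat)
  show "Weq ?N \<subseteq> Arr Arrow_Cat" by (auto simp: weq arr)
  show "Cof ?N \<subseteq> Arr Arrow_Cat" "Fib ?N \<subseteq> Arr Arrow_Cat" by (simp_all add: cof fib)
  show "two_out_of_three Arrow_Cat (Weq ?N)"
    by (auto simp: two_out_of_three_def weq arr)
  \<comment> \<open>The section and retraction maps compare the endpoints in both directions, so in
    a poset a retract equals the arrow it is a retract of; all three closure conditions
    follow.\<close>
  have "fst f = fst g \<and> snd f = snd g" if "retract_of Arrow_Cat f g" for f g
  proof -
    have "(fst f \<longrightarrow> fst g) \<and> (fst g \<longrightarrow> fst f) \<and> (snd f \<longrightarrow> snd g) \<and> (snd g \<longrightarrow> snd f)"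
      using that unfolding retract_of_def Bex_def hom by simp
    then show ?thesis by blast
  qed
  then have "f = g" if "retract_of Arrow_Cat f g" for f g
    using that by (simp add: prod_eq_iff)
  then show "retract_closed Arrow_Cat (Weq ?N)" "retract_closed Arrow_Cat (Cof ?N)"
    "retract_closed Arrow_Cat (Fib ?N)"
    unfolding retract_closed_def by blast+
  show "\<forall>i\<in>Cof ?N. \<forall>p\<in>Fib ?N. i \<in> Weq ?N \<or> p \<in> Weq ?N \<longrightarrow> has_lifting Arrow_Cat i p"
  proof (intro ballI impI)
    fix i p assume ip: "i \<in> Cof ?N" "p \<in> Fib ?N" "i \<in> Weq ?N \<or> p \<in> Weq ?N"
    show "has_lifting Arrow_Cat i p"
      unfolding has_lifting_def
      \<comment> \<open>The lift needs \<open>snd i \<le> fst p\<close>. If \<open>i\<close> is an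
        identity, this is the top arrow of the square; if \<open>p\<close> is, it is the bottom
        arrow.\<close>
      by (intro ballI impI bexI[of _ "(snd i, fst p)"] conjI)
        (use ip in \<open>auto simp: weq cof fib arr hom\<close>)
  qed
  show "\<forall>f\<in>Arr Arrow_Cat. \<exists>i\<in>Cof ?N. \<exists>p\<in>Fib ?N \<inter> Weq ?N.
      Dom Arrow_Cat i = Dom Arrow_Cat f \<and> Cod Arrow_Cat i = Dom Arrow_Cat p \<and>
      Cod Arrow_Cat p = Cod Arrow_Cat f \<and> f = Comp Arrow_Cat i p"
  proof
    fix f assume "f \<in> Arr Arrow_Cat"
    then show "\<exists>i\<in>Cof ?N. \<exists>p\<in>Fib ?N \<inter> Weq ?N.
      Dom Arrow_Cat i = Dom Arrow_Cat f \<and> Cod Arrow_Cat i = Dom Arrow_Cat p \<and>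
      Cod Arrow_Cat p = Cod Arrow_Cat f \<and> f = Comp Arrow_Cat i p"
      by (intro bexI[of _ f] bexI[of _ "(snd f, snd f)"]) (auto simp: weq cof fib arr)
  qed
  show "\<forall>f\<in>Arr Arrow_Cat. \<exists>i\<in>Cof ?N \<inter> Weq ?N. \<exists>p\<in>Fib ?N.
      Dom Arrow_Cat i = Dom Arrow_Cat f \<and> Cod Arrow_Cat i = Dom Arrow_Cat p \<and>
      Cod Arrow_Cat p = Cod Arrow_Cat f \<and> f = Comp Arrow_Cat i p"
  proof
    fix f assume "f \<in> Arr Arrow_Cat"
    then show "\<exists>i\<in>Cof ?N \<inter> Weq ?N. \<exists>p\<in>Fib ?N.
      Dom Arrow_Cat i = Dom Arrow_Cat f \<and> Cod Arrow_Cat i = Dom Arrow_Cat p \<and>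
      Cod Arrow_Cat p = Cod Arrow_Cat f \<and> f = Comp Arrow_Cat i p"
      by (intro bexI[of _ f] bexI[of _ "(fst f, fst f)"]) (auto simp: weq cof fib arr)
  qed
qed

section \<open>The empty and the terminal double category\<close>

lemmas empty_dbl_eq = empty_dbl_def[unfolded Let_def]
lemmas one_dbl_eq = one_dbl_def[unfolded Let_def]
lemmas dblcat_cat_defs = HorCat_def VerCat_def SqVCat_def SqHCat_def

lemma DblCat_simps [simp]:
  "A \<in> Obj DblCat \<longleftrightarrow> double_category A \<and> small A"
  "Dom DblCat = src" "Cod DblCat = tgt" "Id DblCat = dbl_id" "Comp DblCat = dbl_comp"
  by (simp_all add: DblCat_def)

lemma hom_set_DblCat:
  "F \<in> hom_set DblCat A B \<longleftrightarrow>
    src F = A \<and> tgt F = B \<and> A \<in> Obj DblCat \<and> B \<in> Obj DblCat \<and> double_functor F"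
  by (auto simp: hom_set_def DblCat_def)

lemma Arr_DblCat_iff_hom_set: "F \<in> Arr DblCat \<longleftrightarrow> F \<in> hom_set DblCat (src F) (tgt F)"
  by (simp add: hom_set_def)

lemma small_empty_dbl: "small empty_dbl"
proof -
  have "({} :: 'a set) \<prec> (UNIV :: 'a set)"
    by (simp add: lesspoll_def) (metis empty_not_UNIV eqpoll_sym eqpoll_empty_iff_empty)
  then show ?thesis by (simp add: small_def empty_dbl_eq)
qed

text \<open>Here the infinitude of \<open>'u\<close> enters: it makes a singleton strictly smaller
  than the universe.\<close>

lemma small_one_dbl: "small (one_dbl :: 'u::infinite dblcat)"
proof -
  have "{undefined :: 'u} \<prec> (UNIV :: 'u set)"
    by (rule finite_lesspoll_infinite) (simp_all add: infinite_UNIV)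
  then show ?thesis by (simp add: small_def one_dbl_eq)
qed

lemma double_category_empty_dbl: "double_category empty_dbl"
  by (simp add: double_category_def dblcat_cat_defs empty_dbl_eq category_def normalized_def
      is_functor_def extensional_def)

lemma double_category_one_dbl: "double_category one_dbl"
  by (simp add: double_category_def dblcat_cat_defs one_dbl_eq category_def normalized_def
      is_functor_def extensional_def hom_set_def)

text \<open>Cells have boundaries, so without objects there are no cells at all. Normalization then
  makes every structure map constantly \<open>undefined\<close>, which gives equality of records and
  not only an isomorphism. \<open>P_ob\<close> is an inequality of records and needs this strict
  form.\<close>

lemma double_category_empty_Ob:
  assumes "double_category A" "Ob A = {}"
  shows "A = empty_dbl"
proof -
  have "Hor A = {}" "Ver A = {}"
    using assms by (auto simp: double_category_def category_def HorCat_def VerCat_def)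
  moreover from this have "Sq A = {}"
    using assms by (auto simp: double_category_def category_def SqVCat_def)
  ultimately show ?thesis
    using assms unfolding double_category_def normalized_def dblcat_cat_defs empty_dbl_eq
    by (intro dblcat.equality) (auto simp: extensional_def fun_eq_iff)
qed

section \<open>Double functors into the values of the right adjoint\<close>

lemma R_ob_in_DblCat: "(R_ob X :: 'u::infinite dblcat) \<in> Obj DblCat"
  by (simp add: R_ob_def double_category_one_dbl double_category_empty_dbl small_one_dbl
      small_empty_dbl)

lemma P_ob_iff_Ob: "double_category A \<Longrightarrow> P_ob A \<longleftrightarrow> Ob A \<noteq> {}"
  using double_category_empty_Ob by (auto simp: P_ob_def empty_dbl_eq)

lemma P_ob_mono:
  assumes "F \<in> hom_set DblCat A B" "P_ob A"
  shows "P_ob B"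
proof -
  have "fob F ` Ob A \<subseteq> Ob B"
    using assms by (auto simp: hom_set_DblCat double_functor_def is_functor_def HorCat_def Let_def)
  then show ?thesis using assms by (auto simp: P_ob_iff_Ob hom_set_DblCat)
qed

lemma P_ob_R_ob [simp]: "P_ob (R_ob X) = X"
  by (auto simp: P_ob_def R_ob_def one_dbl_eq empty_dbl_eq)

lemma const_dbl_one:
  assumes "A \<in> Obj DblCat"
  shows "const_dbl A one_dbl \<in> hom_set DblCat A (one_dbl :: 'u::infinite dblcat)"
proof -
  have "double_functor (const_dbl A one_dbl)"
    by (simp add: const_dbl_def double_functor_def Let_def is_functor_def extensional_def
        dblcat_cat_defs one_dbl_eq hom_set_def)
  then show ?thesis
    using R_ob_in_DblCat[of True] assms by (simp add: hom_set_DblCat R_ob_def const_dbl_def)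
qed

lemma const_dbl_empty:
  assumes "B \<in> Obj DblCat"
  shows "const_dbl empty_dbl B \<in> hom_set DblCat (empty_dbl :: 'u::infinite dblcat) B"
proof -
  have "double_functor (const_dbl empty_dbl B)"
    by (simp add: const_dbl_def double_functor_def Let_def is_functor_def extensional_def
        dblcat_cat_defs empty_dbl_eq)
  then show ?thesis
    using R_ob_in_DblCat[of False] assms by (simp add: hom_set_DblCat R_ob_def const_dbl_def)
qed

lemma hom_from_empty_unique:
  assumes "F \<in> hom_set DblCat empty_dbl B"
  shows "F = const_dbl empty_dbl B"
  using assms
  by (intro dblfun.equality)
    (auto simp: hom_set_DblCat const_dbl_def double_functor_def Let_def extensional_def
      empty_dbl_eq fun_eq_iff)

text \<open>On cells the values are forced because \<open>one_dbl\<close> has one cell of each kind,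
  namely \<open>undefined\<close>; off the cells extensionality forces the same element. Hence all
  four components are constant functions.\<close>

lemma hom_to_one_unique:
  assumes "F \<in> hom_set DblCat A one_dbl"
  shows "F = const_dbl A one_dbl"
proof (rule dblfun.equality)
  have F: "double_functor F" "src F = A" "tgt F = one_dbl"
    using assms by (simp_all add: hom_set_DblCat)
  then have "\<forall>x\<in>Ob A. fob F x = undefined" "\<forall>x\<in>Hor A. fhor F x = undefined"
    "\<forall>x\<in>Ver A. fver F x = undefined" "\<forall>x\<in>Sq A. fsq F x = undefined"
    by (auto simp: double_functor_def Let_def is_functor_def hom_set_def dblcat_cat_defs one_dbl_eq)
  moreover have "fob F \<in> extensional (Ob A)" "fhor F \<in> extensional (Hor A)"
    "fver F \<in> extensional (Ver A)" "fsq F \<in> extensional (Sq A)"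
    using F by (auto simp: double_functor_def Let_def)
  ultimately show "fob F = fob (const_dbl A one_dbl)" "fhor F = fhor (const_dbl A one_dbl)"
    "fver F = fver (const_dbl A one_dbl)" "fsq F = fsq (const_dbl A one_dbl)"
    by (auto simp: const_dbl_def extensional_def fun_eq_iff)
qed (use assms in \<open>auto simp: hom_set_DblCat const_dbl_def\<close>)

text \<open>The right-hand side has the shape of the hom set from \<open>P_ob A\<close> to
  \<open>X\<close> in \<open>Arrow_Cat\<close>, so this computation carries the adjunction
  bijection.\<close>

lemma hom_set_R_ob:
  fixes A :: "'u::infinite dblcat"
  assumes "A \<in> Obj DblCat"
  shows "hom_set DblCat A (R_ob X) = (if P_ob A \<longrightarrow> X then {const_dbl A (R_ob X)} else {})"
proof (cases "P_ob A \<longrightarrow> X")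
  case True
  \<comment> \<open>Either the target is terminal or the source is initial; each alone makes
    \<open>const_dbl\<close> the unique double functor.\<close>
  then have "X \<or> A = empty_dbl" by (auto simp: P_ob_def)
  then have "const_dbl A (R_ob X) \<in> hom_set DblCat A (R_ob X)"
    using const_dbl_one[OF assms] const_dbl_empty[OF R_ob_in_DblCat, of X] by (auto simp: R_ob_def)
  moreover have "F = const_dbl A (R_ob X)" if "F \<in> hom_set DblCat A (R_ob X)" for F
    using \<open>X \<or> A = empty_dbl\<close>
  proof
    assume X then show ?thesis using that hom_to_one_unique by (simp add: R_ob_def)
  next
    assume "A = empty_dbl" then show ?thesis using that hom_from_empty_unique by blast
  qed
  ultimately have "hom_set DblCat A (R_ob X) = {const_dbl A (R_ob X)}" by blast
  then show ?thesis using True by simp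
next
  case False
  then show ?thesis using P_ob_mono[of _ A "R_ob X"] by auto
qed

text \<open>Reduces an equation between double functors into \<open>R_ob X\<close> to a check of
  source and target. Functoriality of \<open>R_arr\<close> and naturality of the transpose are
  obtained this way, without computing composites.\<close>

lemma hom_to_R_ob_unique:
  assumes "F \<in> hom_set DblCat A (R_ob X)"
  shows "F = const_dbl A (R_ob X)"
proof -
  have "A \<in> Obj DblCat" using assms by (simp add: hom_set_DblCat)
  then show ?thesis using assms by (simp add: hom_set_R_ob split: if_splits)
qed

lemma terminal_obj_one_dbl: "terminal_obj DblCat (one_dbl :: 'u::infinite dblcat)"
proof -
  have "one_dbl \<in> Obj (DblCat :: ('u dblcat, 'u dblfun) cat)"
    using R_ob_in_DblCat[of True] by (simp add: R_ob_def)
  then show ?thesis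
    unfolding terminal_obj_def using const_dbl_one hom_to_one_unique by blast
qed

section \<open>The adjunction\<close>

lemma functor_P: "is_functor DblCat Arrow_Cat P_ob P_arr"
proof -
  have "P_ob (src F) \<Longrightarrow> P_ob (tgt F)" if "F \<in> Arr DblCat" for F :: "'a dblfun"
    using that P_ob_mono Arr_DblCat_iff_hom_set by blast
  then show ?thesis
    by (auto simp: is_functor_def Arrow_Cat_def hom_set_def P_arr_def dbl_id_def dbl_comp_def)
qed

lemma R_arr_in_hom_set:
  assumes "f \<in> Arr Arrow_Cat"
  shows "(R_arr f :: 'u::infinite dblfun) \<in> hom_set DblCat (R_ob (fst f)) (R_ob (snd f))"
  using assms
  by (cases f) (simp add: R_arr_def hom_set_R_ob[OF R_ob_in_DblCat] Arrow_Cat_def)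

lemma functor_R:
  assumes "category (DblCat :: ('u::infinite dblcat, 'u dblfun) cat)"
  shows "is_functor Arrow_Cat (DblCat :: ('u::infinite dblcat, 'u dblfun) cat) R_ob R_arr"
  unfolding is_functor_def
proof (intro conjI ballI impI)
  fix a show "(R_ob a :: 'u dblcat) \<in> Obj DblCat" by (rule R_ob_in_DblCat)
next
  show "(R_arr f :: 'u dblfun)
      \<in> hom_set DblCat (R_ob (Dom Arrow_Cat f)) (R_ob (Cod Arrow_Cat f))"
    if "f \<in> Arr Arrow_Cat" for f
    using R_arr_in_hom_set[OF that] by (simp add: Arrow_Cat_def)
  fix a :: bool
  have "Id DblCat (R_ob a :: 'u dblcat) \<in> hom_set DblCat (R_ob a) (R_ob a)"
    using assms R_ob_in_DblCat[of a] unfolding category_def by blast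
  from hom_to_R_ob_unique[OF this]
  show "(R_arr (Id Arrow_Cat a) :: 'u dblfun) = Id DblCat (R_ob a)"
    by (simp add: R_arr_def Arrow_Cat_def)
  fix f g assume fg: "f \<in> Arr Arrow_Cat" "g \<in> Arr Arrow_Cat" "Cod Arrow_Cat f = Dom Arrow_Cat g"
  have "Comp DblCat (R_arr f) (R_arr g :: 'u dblfun) \<in> hom_set DblCat (R_ob (fst f)) (R_ob (snd g))"
    using Comp_in_hom_set[OF assms R_arr_in_hom_set[OF fg(1)]] R_arr_in_hom_set[OF fg(2)] fg(3)
    by (simp add: Arrow_Cat_def)
  from hom_to_R_ob_unique[OF this]
  show "R_arr (Comp Arrow_Cat f g) = Comp DblCat (R_arr f) (R_arr g :: 'u dblfun)"
    by (simp only: R_arr_def) (simp add: Arrow_Cat_def)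
qed

text \<open>The category axioms for \<open>DblCat\<close> are a clause of
  \<open>model_structure\<close>, from which the final proof takes them.\<close>

lemma adjunction_PR:
  assumes cat: "category (DblCat :: ('u::infinite dblcat, 'u dblfun) cat)"
  shows "adjunction (DblCat :: ('u::infinite dblcat, 'u dblfun) cat) Arrow_Cat
    P_ob P_arr R_ob R_arr PR_transpose"
  unfolding adjunction_def
proof (intro conjI ballI)
  show "category (DblCat :: ('u dblcat, 'u dblfun) cat)" by fact
  show "category Arrow_Cat" by (rule category_Arrow_Cat)
  show "is_functor (DblCat :: ('u dblcat, 'u dblfun) cat) Arrow_Cat P_ob P_arr"
    by (rule functor_P)
  show "is_functor Arrow_Cat (DblCat :: ('u dblcat, 'u dblfun) cat) R_ob R_arr"
    by (rule functor_R[OF cat])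
next
  fix A :: "'u dblcat" and X
  assume A: "A \<in> Obj DblCat"
  have "hom_set Arrow_Cat (P_ob A) X = (if P_ob A \<longrightarrow> X then {(P_ob A, X)} else {})"
    by (auto simp: hom_set_def Arrow_Cat_def)
  then show "bij_betw (PR_transpose A X) (hom_set Arrow_Cat (P_ob A) X)
      (hom_set DblCat A (R_ob X))"
    unfolding hom_set_R_ob[OF A] by (auto simp: bij_betw_def PR_transpose_def)
next
  fix F :: "'u dblfun" and g h
  assume F: "F \<in> Arr DblCat" and g: "g \<in> Arr Arrow_Cat"
    and h: "h \<in> hom_set Arrow_Cat (P_ob (Cod DblCat F)) (Dom Arrow_Cat g)"
  have F': "F \<in> hom_set DblCat (src F) (tgt F)" "src F \<in> Obj DblCat" "tgt F \<in> Obj DblCat"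
    using F by (auto simp: DblCat_def hom_set_def)
  \<comment> \<open>The arrow \<open>h\<close> witnesses this inequality, which ensures that the
    constant data of its transpose form a double functor.\<close>
  have "P_ob (tgt F) \<longrightarrow> fst g"
    using h by (auto simp: hom_set_def Arrow_Cat_def)
  then have "PR_transpose (tgt F) (fst g) h \<in> hom_set DblCat (tgt F) (R_ob (fst g))"
    by (simp add: hom_set_R_ob[OF F'(3)] PR_transpose_def)
  moreover have "(R_arr g :: 'u dblfun) \<in> hom_set DblCat (R_ob (fst g)) (R_ob (snd g))"
    by (rule R_arr_in_hom_set[OF g])
  ultimately have "Comp DblCat F (Comp DblCat (PR_transpose (tgt F) (fst g) h) (R_arr g))
      \<in> hom_set DblCat (src F) (R_ob (snd g))"
    using F'(1) Comp_in_hom_set[OF cat] by blast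
  from hom_to_R_ob_unique[OF this]
  show "PR_transpose (Dom DblCat F) (Cod Arrow_Cat g)
      (Comp Arrow_Cat (P_arr F) (Comp Arrow_Cat h g)) =
    Comp DblCat F (Comp DblCat (PR_transpose (Cod DblCat F) (Dom Arrow_Cat g) h) (R_arr g))"
    by (simp add: PR_transpose_def Arrow_Cat_def)
qed

section \<open>Weak equivalences between empty, nonempty and terminal double categories\<close>

text \<open>Used twice: for the preservation of trivial cofibrations by \<open>P_arr\<close>, and to
  identify the middle object when the map from \<open>empty_dbl\<close> to \<open>one_dbl\<close> is
  factored.\<close>

lemma trivial_cofibration_from_empty:
  fixes M :: "('u::infinite) dblfun model"
  assumes M: "is_DblCat_empty_ctr M" and i: "i \<in> Cof M" "i \<in> Weq M" "src i = empty_dbl"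
  shows "tgt i = empty_dbl"
proof -
  have ms: "model_structure DblCat M" using M by (simp add: is_DblCat_empty_ctr_def)
  then have cat: "category (DblCat :: ('u dblcat, 'u dblfun) cat)"
    by (simp add: model_structure_def)
  have empty: "(empty_dbl :: 'u dblcat) \<in> Obj DblCat"
    using R_ob_in_DblCat[of False] by (simp add: R_ob_def)
  have i_hom: "i \<in> hom_set DblCat empty_dbl (tgt i)"
    using ms i unfolding model_structure_def by (auto simp: hom_set_def)
  have "fibrant DblCat M empty_dbl"
    using M empty unfolding is_DblCat_empty_ctr_def by blast
  \<comment> \<open>\<open>fibrant\<close> provides some terminal object, not necessarily
    \<open>one_dbl\<close>; terminality of \<open>t\<close> is what yields the map \<open>q\<close>
    below.\<close>
  then obtain t p where t: "terminal_obj DblCat t"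
    and p: "p \<in> hom_set DblCat empty_dbl t" "p \<in> Fib M"
    unfolding fibrant_def by blast
  obtain q where q: "q \<in> hom_set DblCat (tgt i) t"
    using t i_hom unfolding terminal_obj_def by (metis hom_set_DblCat)
  have id: "dbl_id empty_dbl \<in> hom_set DblCat empty_dbl (empty_dbl :: 'u dblcat)"
    using cat empty unfolding category_def by auto
  \<comment> \<open>The lifting square commutes because both composites start at the initial object
    \<open>empty_dbl\<close>.\<close>
  have "Comp DblCat (dbl_id empty_dbl) p = const_dbl empty_dbl t"
    "Comp DblCat i q = const_dbl empty_dbl t"
    using Comp_in_hom_set[OF cat] hom_from_empty_unique id p(1) i_hom q by blast+
  then have square: "Comp DblCat (dbl_id empty_dbl) p = Comp DblCat i q" by simp
  have "has_lifting DblCat i p"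
    using ms i p(2) unfolding model_structure_def by blast
  moreover have "src p = empty_dbl" "tgt p = t"
    using p(1) by (simp_all add: hom_set_DblCat)
  ultimately have "\<forall>s\<in>hom_set DblCat empty_dbl empty_dbl. \<forall>r\<in>hom_set DblCat (tgt i) t.
      Comp DblCat s p = Comp DblCat i r \<longrightarrow> (\<exists>l. l \<in> hom_set DblCat (tgt i) empty_dbl)"
    using i(3) unfolding has_lifting_def by (simp only: DblCat_simps) blast
  with id q square obtain l where "l \<in> hom_set DblCat (tgt i) (empty_dbl :: 'u dblcat)"
    by blast
  \<comment> \<open>The lift is a double functor into \<open>empty_dbl\<close>, so its source cannot
    have objects.\<close>
  from P_ob_mono[OF this] show ?thesis by (auto simp: P_ob_def)
qed

text \<open>Between its only objects \<open>one_dbl\<close> has a single arrow in each direction, so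
  any arrow provided by essential fullness is already a strict preimage. The condition on objects
  provides an object of \<open>A\<close>, hence surjectivity; the condition on squares is common to
  both notions.\<close>

lemma gregarious_over_one_canonical:
  assumes "gregarious_double_equivalence (const_dbl A one_dbl)"
  shows "canonical_trivial_fibration (const_dbl A one_dbl)"
proof -
  have "\<exists>a. a \<in> Ob A"
    using assms
    by (auto simp: gregarious_double_equivalence_def const_dbl_def one_dbl_eq)
  moreover have "full_on (HorCat A) (HorCat one_dbl) (\<lambda>x. undefined) (\<lambda>x. undefined)"
    using assms unfolding gregarious_double_equivalence_def
    by (fastforce simp: ess_full_on_morphisms_def full_on_def horizontal_2cat_def const_dbl_def
        one_dbl_eq HorCat_def hom_set_def)
  moreover have "full_on (VerCat A) (VerCat one_dbl) (\<lambda>x. undefined) (\<lambda>x. undefined)"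
    using assms unfolding gregarious_double_equivalence_def
    by (fastforce simp: ess_full_on_morphisms_def full_on_def vertical_2cat_def const_dbl_def
        one_dbl_eq VerCat_def hom_set_def)
  moreover have "fully_faithful_on_squares (const_dbl A one_dbl)"
    using assms by (simp add: gregarious_double_equivalence_def)
  ultimately show ?thesis
    by (auto simp: canonical_trivial_fibration_def const_dbl_def one_dbl_eq)
qed

text \<open>Uniqueness of maps to \<open>one_dbl\<close> puts the second factor in the form
  \<open>const_dbl (tgt i) one_dbl\<close>, so that its being a fibration says that the middle
  object is fibrant.\<close>

lemma factor_trivial_cofibration:
  fixes M :: "('u::infinite) dblfun model"
  assumes "model_structure DblCat M" "A \<in> Obj DblCat"
  obtains i where "i \<in> Cof M" "i \<in> Weq M" "i \<in> hom_set DblCat A (tgt i)"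
    "const_dbl (tgt i) one_dbl \<in> Fib M"
    "const_dbl A one_dbl = dbl_comp i (const_dbl (tgt i) one_dbl)"
proof -
  let ?c = "const_dbl A one_dbl"
  have c: "?c \<in> Arr DblCat" "src ?c = A" "tgt ?c = one_dbl"
    using const_dbl_one[OF assms(2)] by (auto simp: hom_set_def)
  have "\<forall>f\<in>Arr DblCat. \<exists>i\<in>Cof M \<inter> Weq M. \<exists>p\<in>Fib M.
      src i = src f \<and> tgt i = src p \<and> tgt p = tgt f \<and> f = dbl_comp i p"
    using assms(1) unfolding model_structure_def by auto
  with c obtain i p where ip: "i \<in> Cof M" "i \<in> Weq M" "p \<in> Fib M" "src i = A" "tgt i = src p"
    "tgt p = one_dbl" "?c = dbl_comp i p"
    by (metis IntE)
  have "i \<in> Arr DblCat" "p \<in> Arr DblCat"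
    using assms(1) ip unfolding model_structure_def by auto
  then have "i \<in> hom_set DblCat A (tgt i)" "p \<in> hom_set DblCat (tgt i) one_dbl"
    using ip by (auto simp: hom_set_def)
  with ip hom_to_one_unique that show ?thesis by metis
qed

lemma nonempty_to_one_weq:
  fixes M :: "('u::infinite) dblfun model"
  assumes M: "is_DblCat_empty_ctr M" and A: "A \<in> Obj DblCat" "P_ob A"
  shows "const_dbl A one_dbl \<in> Weq M"
proof -
  have ms: "model_structure DblCat M" using M by (simp add: is_DblCat_empty_ctr_def)
  obtain i where i: "i \<in> Cof M" "i \<in> Weq M" "i \<in> hom_set DblCat A (tgt i)"
    and p: "const_dbl (tgt i) one_dbl \<in> Fib M"
    and comp: "const_dbl A one_dbl = dbl_comp i (const_dbl (tgt i) one_dbl)"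
    using factor_trivial_cofibration[OF ms A(1)] by blast
  \<comment> \<open>Nonemptiness passes along \<open>i\<close> and excludes the first alternative in
    the description of fibrant objects.\<close>
  have B: "tgt i \<in> Obj DblCat" "tgt i \<noteq> empty_dbl"
    using i(3) P_ob_mono[OF i(3) A(2)] by (auto simp: hom_set_DblCat P_ob_def)
  have p_hom: "const_dbl (tgt i) one_dbl \<in> hom_set DblCat (tgt i) (one_dbl :: 'u dblcat)"
    by (rule const_dbl_one[OF B(1)])
  then have "fibrant DblCat M (tgt i)"
    unfolding fibrant_def using B(1) p terminal_obj_one_dbl by blast
  then have "canonical_trivial_fibration (const_dbl (tgt i) one_dbl)"
    using M B gregarious_over_one_canonical unfolding is_DblCat_empty_ctr_def by blast
  then have "const_dbl (tgt i) one_dbl \<in> Weq M"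
    using M p_hom unfolding is_DblCat_empty_ctr_def hom_set_def by blast
  moreover have "two_out_of_three DblCat (Weq M)"
    using ms by (simp add: model_structure_def)
  ultimately show ?thesis
    using i p_hom unfolding comp two_out_of_three_def hom_set_def by auto
qed

lemma empty_to_one_not_weq:
  fixes M :: "('u::infinite) dblfun model"
  assumes M: "is_DblCat_empty_ctr M"
  shows "const_dbl empty_dbl one_dbl \<notin> Weq M"
proof
  assume weq: "const_dbl empty_dbl one_dbl \<in> Weq M"
  have ms: "model_structure DblCat M" using M by (simp add: is_DblCat_empty_ctr_def)
  have empty: "(empty_dbl :: 'u dblcat) \<in> Obj DblCat"
    using R_ob_in_DblCat[of False] by (simp add: R_ob_def)
  obtain i where i: "i \<in> Cof M" "i \<in> Weq M" "i \<in> hom_set DblCat empty_dbl (tgt i)"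
    and p: "const_dbl (tgt i) one_dbl \<in> Fib M"
    using factor_trivial_cofibration[OF ms empty] by blast
  have "tgt i = empty_dbl"
    using trivial_cofibration_from_empty[OF M i(1,2)] i(3) by (simp add: hom_set_DblCat)
  \<comment> \<open>With an empty middle object, the fibration from the factorization is the assumed
    weak equivalence itself. Surjectivity on objects then fails.\<close>
  then have "canonical_trivial_fibration (const_dbl empty_dbl (one_dbl :: 'u dblcat))"
    using M p weq const_dbl_one[OF empty] unfolding is_DblCat_empty_ctr_def hom_set_def by auto
  then show False
    by (simp add: canonical_trivial_fibration_def const_dbl_def empty_dbl_eq one_dbl_eq)
qed

text \<open>All conditions of a canonical trivial fibration hold vacuously, and trivial fibrations
  are weak equivalences.\<close>

lemma empty_to_empty_weq:
  fixes M :: "('u::infinite) dblfun model"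
  assumes M: "is_DblCat_empty_ctr M"
  shows "const_dbl empty_dbl empty_dbl \<in> Weq M"
proof -
  have "const_dbl empty_dbl (empty_dbl :: 'u dblcat) \<in> Arr DblCat"
    using const_dbl_empty[OF R_ob_in_DblCat[of False, where 'u = 'u]]
    by (simp add: R_ob_def hom_set_def)
  moreover have "canonical_trivial_fibration (const_dbl empty_dbl (empty_dbl :: 'u dblcat))"
    by (simp add: canonical_trivial_fibration_def const_dbl_def empty_dbl_eq full_on_def
        fully_faithful_on_squares_def HorCat_def VerCat_def)
  ultimately show ?thesis using M unfolding is_DblCat_empty_ctr_def by blast
qed

theorem theorem8p9:
  fixes M :: "('u::infinite) dblfun model"
  assumes "is_DblCat_empty_ctr M"
  shows "quillen_equivalence DblCat M Arrow_Cat (trivial_model Arrow_Cat)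
           P_ob P_arr R_ob R_arr PR_transpose"
proof -
  let ?N = "trivial_model Arrow_Cat"
  have ms: "model_structure DblCat M" using assms by (simp add: is_DblCat_empty_ctr_def)
  \<comment> \<open>All arrows are cofibrations in the trivial model structure, so this settles the
    preservation of cofibrations.\<close>
  have arr: "P_arr F \<in> Arr Arrow_Cat" if "F \<in> Cof M" for F
    using that ms functor_P unfolding model_structure_def is_functor_def hom_set_def by blast
  have "is_iso Arrow_Cat (P_arr F)" if F: "F \<in> Cof M" "F \<in> Weq M" for F
  proof -
    have "P_ob (src F) \<Longrightarrow> P_ob (tgt F)"
      using arr[OF F(1)] by (auto simp: P_arr_def Arrow_Cat_def)
    then show ?thesis
      using trivial_cofibration_from_empty[OF assms F]
      by (auto simp: is_iso_Arrow_Cat P_arr_def P_ob_def)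
  qed
  with arr have adj: "quillen_adjunction DblCat M Arrow_Cat ?N P_ob P_arr R_ob R_arr PR_transpose"
    using ms model_structure_trivial_Arrow_Cat adjunction_PR
    by (auto simp: quillen_adjunction_def trivial_model_def model_structure_def)
  have "h \<in> Weq ?N \<longleftrightarrow> PR_transpose A X h \<in> Weq M"
    if A: "cofibrant DblCat M A" and h: "h \<in> hom_set Arrow_Cat (P_ob A) X" for A X h
  proof -
    have "A \<in> Obj DblCat" using A by (simp add: cofibrant_def)
    \<comment> \<open>The existence of \<open>h\<close> excludes a nonempty \<open>A\<close> with
      \<open>X\<close> false. Of the three remaining cases, \<open>h\<close> is invertible for
      nonempty to terminal and for empty to empty, but not for empty to terminal; the three
      preceding lemmas give the same answer for the transpose.\<close>
    have "h = (P_ob A, X)" "P_ob A \<longrightarrow> X"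
      using h by (auto simp: hom_set_def Arrow_Cat_def)
    then show ?thesis
      using nonempty_to_one_weq[OF assms \<open>A \<in> Obj DblCat\<close>] empty_to_one_not_weq[OF assms]
        empty_to_empty_weq[OF assms]
      by (cases "P_ob A"; cases X)
        (auto simp: trivial_model_def is_iso_Arrow_Cat PR_transpose_def R_ob_def P_ob_def)
  qed
  with adj show ?thesis by (simp add: quillen_equivalence_def)
qed

end
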